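(* For any constant $0<p_1<1$, there is an algorithm that detects, with probability at least $\left(1-\frac{\log n}{n}\right)^2$, both targets $t_1,t_2$ in any tree with $n$ vertices using $O(\log^2 n)$ direction queries.
   Context: All logarithms are base $2$. Graphs $G=(V,E)$ are connected, simple, undirected, with positive edge weights $w$; $d$ is the shortest-path distance, and $N(v)$ is the set of neighbors of $v$. For $u\in N(v)$, $N(v,u)=\{x\in V: d(v,x)=w(vu)+d(u,x)\}$. There are two unknown targets $t_1,t_2\in V$. Let $p_2=1-p_1$. Each direction query at a vertex $v$ independently directs to $t_1$ with probability $p_1$ and to $t_2$ with probability $p_2$; when it directs to $t_i$ it returns a neighbor $u\in N(v)$ with $t_i\in N(v,u)$ (without disclosing $i$). If $v=t_i$, this is revealed by the query with probability $p_i$. The constant in $O(\cdot)$ may depend on $p_1$. *)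

theory Defs
  imports
    "HOL-Probability.Probability_Mass_Function"
    "HOL-Library.Landau_Symbols"
    "Graph_Theory.Digraph_Component"
    "Graph_Theory.Pair_Digraph"
    "Graph_Theory.Shortest_Path"
begin

text \<open>An undirected edge \<open>uv\<close> is represented by the two arcs \<open>(u, v)\<close> and \<open>(v, u)\<close>. These form a
  \<^const>\<open>pre_digraph.cycle\<close> of length 2, so only cycles with at least 3 arcs are cycles of the
  undirected graph. (For the same reason \<^const>\<open>Digraph_Component.tree\<close> does not fit here.)
  \<^const>\<open>pair_graph\<close> says that the graph is finite and simple;
  \<^const>\<open>Digraph_Component.connected\<close> includes that it has a vertex.\<close>

definition undirected_tree :: "'v pair_pre_digraph \<Rightarrow> bool" where
  "undirected_tree G \<longleftrightarrow> pair_graph G \<and> Digraph_Component.connected (with_proj G) \<and>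
     \<not> (\<exists>p. pre_digraph.cycle (with_proj G) p \<and> 3 \<le> length p)"

definition pos_edge_weights :: "'v pair_pre_digraph \<Rightarrow> ('v \<times> 'v \<Rightarrow> real) \<Rightarrow> bool" where
  "pos_edge_weights G w \<longleftrightarrow> (\<forall>(u, v) \<in> parcs G. 0 < w (u, v) \<and> w (u, v) = w (v, u))"

definition sp_dist :: "'v pair_pre_digraph \<Rightarrow> ('v \<times> 'v \<Rightarrow> real) \<Rightarrow> 'v \<Rightarrow> 'v \<Rightarrow> ereal" where
  "sp_dist G w = wf_digraph.\<mu> (with_proj G) w"

definition nbrs :: "'v pair_pre_digraph \<Rightarrow> 'v \<Rightarrow> 'v set" where
  "nbrs G v = {u. (v, u) \<in> parcs G}"

definition nbrs_via :: "'v pair_pre_digraph \<Rightarrow> ('v \<times> 'v \<Rightarrow> real) \<Rightarrow> 'v \<Rightarrow> 'v \<Rightarrow> 'v set" where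
  "nbrs_via G w v u = {x \<in> pverts G. sp_dist G w v x = ereal (w (v, u)) + sp_dist G w u x}"

text \<open>\<open>dir v t\<close> is the neighbor returned by a query at \<open>v\<close> that directs to \<open>t \<noteq> v\<close>. In a tree this
  neighbor is unique, so a fixed choice function is no restriction on the oracle. The values of
  \<open>dir\<close> elsewhere are unconstrained.\<close>

definition direction_fun ::
    "'v pair_pre_digraph \<Rightarrow> ('v \<times> 'v \<Rightarrow> real) \<Rightarrow> ('v \<Rightarrow> 'v \<Rightarrow> 'v) \<Rightarrow> bool" where
  "direction_fun G w dir \<longleftrightarrow>
     (\<forall>v \<in> pverts G. \<forall>t \<in> pverts G. t \<noteq> v \<longrightarrow>
        dir v t \<in> nbrs G v \<and> t \<in> nbrs_via G w v (dir v t))"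

text \<open>The answer \<open>None\<close> reveals that the queried vertex is a target. No answer discloses which of the
  two targets it refers to.\<close>

definition answer_towards :: "('v \<Rightarrow> 'v \<Rightarrow> 'v) \<Rightarrow> 'v \<Rightarrow> 'v \<Rightarrow> 'v option" where
  "answer_towards dir v t = (if v = t then None else Some (dir v t))"

definition direction_query ::
    "real \<Rightarrow> ('v \<Rightarrow> 'v \<Rightarrow> 'v) \<Rightarrow> 'v \<Rightarrow> 'v \<Rightarrow> 'v \<Rightarrow> 'v option pmf" where
  "direction_query p1 dir t1 t2 v =
     map_pmf (\<lambda>first. answer_towards dir v (if first then t1 else t2)) (bernoulli_pmf p1)"

text \<open>An adaptive query algorithm on a known graph is a decision tree: it either stops with a set of
  detected vertices, or queries a vertex and continues depending on the answer.\<close>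

datatype 'v strategy =
    Output "'v set"
  | Query 'v "'v option \<Rightarrow> 'v strategy"

text \<open>The joint distribution of the output and of the list of queried vertices; every query draws a
  fresh answer from the oracle, independently of all earlier ones.\<close>

primrec run :: "('v \<Rightarrow> 'v option pmf) \<Rightarrow> 'v strategy \<Rightarrow> ('v set \<times> 'v list) pmf" where
  "run ask (Output S) = return_pmf (S, [])"
| "run ask (Query v cont) =
     bind_pmf (ask v) (\<lambda>r. map_pmf (\<lambda>(S, vs). (S, v # vs)) (run ask (cont r)))"

end

theory Submission
  imports Defs
begin

text \<open>Repeating a query at \<open>v\<close> for \<open>O(log n)\<close> rounds reveals, with failure probability polynomially
  small in \<open>n\<close>, the set of the answers for both targets, so it suffices to search with
  \<open>O(log n)\<close> such exact set queries. Query a centroid of the candidates. If both targets give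
  the same answer, the candidates are halved. Otherwise the targets are separated, and each is located
  by its own centroid search. Such a search never leaves the branch containing its target, so the
  other target always contributes the known direction out of the branch, and the rest of the answer
  set tells how to halve the candidates.\<close>

section \<open>Decision trees and repeated queries\<close>

lemma card_le_1_subset_singleton:
  assumes "finite A" and "card A \<le> 1"
  shows "\<exists>x. A \<subseteq> {x}"
proof (cases "A = {}")
  case False
  then obtain x where "x \<in> A" by blast
  moreover have "\<forall>y\<in>A. \<forall>z\<in>A. y = z" using assms card_le_Suc0_iff_eq[of A] by simp
  ultimately have "A \<subseteq> {x}" by blast
  then show ?thesis by (rule exI[of _ x])
qed simp

text \<open>A worst-case bound over all answers, including those that no oracle gives, so it speaks
  of the strategy alone and holds for every \<open>ask\<close>.\<close>

primrec queries_within :: "'v set \<Rightarrow> 'v strategy \<Rightarrow> nat \<Rightarrow> bool" where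
  "queries_within V (Output S) = (\<lambda>m. True)"
| "queries_within V (Query v cont) =
     (\<lambda>m. v \<in> V \<and> 0 < m \<and> (\<forall>r. queries_within V (cont r) (m - 1)))"

lemma queries_within_mono: "queries_within V s m \<Longrightarrow> m \<le> m' \<Longrightarrow> queries_within V s m'"
proof (induction s arbitrary: m m')
  case (Query v cont)
  then have "queries_within V (cont r) (m' - 1)" for r
    by (intro Query.IH[of "cont r" "m - 1" "m' - 1"]) auto
  with Query.prems show ?case by simp
qed simp

lemma run_queries_within:
  assumes "queries_within V s m" and "(S, vs) \<in> set_pmf (run ask s)"
  shows "set vs \<subseteq> V \<and> length vs \<le> m"
  using assms
proof (induction s arbitrary: S vs m)
  case (Query v cont)
  then obtain r vs' where r: "(S, vs') \<in> set_pmf (run ask (cont r))" and vs: "vs = v # vs'"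
    by auto
  from Query.prems(1) have "queries_within V (cont r) (m - 1)" "v \<in> V" "0 < m" by auto
  with Query.IH[OF _ this(1) r] vs show ?case by auto
qed auto

text \<open>Direction functions are unconstrained off the tree, so two oracles can be compared only
  at its vertices; for a strategy that queries nothing else this suffices.\<close>

lemma run_cong:
  assumes "queries_within V s m" and "\<And>v. v \<in> V \<Longrightarrow> ask v = ask' v"
  shows "run ask s = run ask' s"
  using assms(1)
proof (induction s arbitrary: m)
  case (Query v cont)
  then have "run ask (cont r) = run ask' (cont r)" for r
    by (intro Query.IH[of "cont r" "m - 1"]) auto
  with Query.prems assms(2) show ?case by simp
qed simp

section \<open>Recovering the set of both answers by repetition\<close>

primrec repeat_query ::
    "nat \<Rightarrow> 'v \<Rightarrow> 'v option set \<Rightarrow> ('v option set \<Rightarrow> 'v strategy) \<Rightarrow> 'v strategy" where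
  "repeat_query 0 v R cont = cont R"
| "repeat_query (Suc j) v R cont = Query v (\<lambda>r. repeat_query j v (insert r R) cont)"

lemma queries_within_repeat_query:
  assumes "v \<in> V" and "\<And>R. queries_within V (cont R) m"
  shows "queries_within V (repeat_query j v R cont) (j + m)"
  using assms by (induction j arbitrary: R) auto

definition failure :: "('v \<Rightarrow> 'v option pmf) \<Rightarrow> 'v set \<Rightarrow> 'v strategy \<Rightarrow> real" where
  "failure ask T s = measure_pmf.prob (run ask s) {x. fst x \<noteq> T}"

lemma failure_Output [simp]: "failure ask T (Output S) = (if S = T then 0 else 1)"
  by (auto simp: failure_def indicator_def)

lemma failure_le_1: "failure ask T s \<le> 1"
  by (simp add: failure_def)

text \<open>Conditioning on which target the first query directs to.\<close>

lemma failure_Query: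
  assumes "0 \<le> p" and "p \<le> 1"
  shows "failure (direction_query p dir t1 t2) T (Query v cont) =
    p * failure (direction_query p dir t1 t2) T (cont (answer_towards dir v t1)) +
    (1 - p) * failure (direction_query p dir t1 t2) T (cont (answer_towards dir v t2))"
proof -
  let ?ask = "direction_query p dir t1 t2"
  have fst_Cons: "fst (case x of (S, vs) \<Rightarrow> (S, v # vs)) = fst x" for x :: "'a set \<times> 'a list"
    by (cases x) simp
  have measure_bind: "measure_pmf.prob (bind_pmf M f) X = measure_pmf.expectation M (\<lambda>x. measure_pmf.prob (f x) X)"
    for M :: "bool pmf" and f :: "bool \<Rightarrow> ('a set \<times> 'a list) pmf" and X
    unfolding measure_pmf_bind
    by (rule measure_pmf.measure_bind[where N="count_space UNIV"]) (auto simp: measure_pmf_in_subprob_space)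
  have "run ?ask (Query v cont) = bernoulli_pmf p \<bind>
      (\<lambda>first. map_pmf (\<lambda>(S, vs). (S, v # vs))
         (run ?ask (cont (answer_towards dir v (if first then t1 else t2)))))"
    by (simp add: direction_query_def bind_map_pmf)
  then show ?thesis
    using assms by (simp add: failure_def measure_bind fst_Cons mult.commute del: run.simps)
qed

text \<open>A single query misses a given answer with probability at most \<open>q\<close>, so an
  answer absent from \<open>R\<close> stays absent through \<open>j\<close> rounds with probability
  at most \<open>q ^ j\<close>. A union bound covers both answers; once both are collected,
  \<open>R\<close> is the exact answer set and only the \<delta> of the continuation
  remains.\<close>

lemma failure_repeat_query:
  fixes p :: real
  assumes p: "0 \<le> p" "p \<le> 1" and q: "p \<le> q" "1 - p \<le> q"
    and cont: "failure (direction_query p dir t1 t2) T (cont (answer_towards dir v ` {t1, t2})) \<le> \<delta>"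
    and R: "R \<subseteq> answer_towards dir v ` {t1, t2}"
  shows "failure (direction_query p dir t1 t2) T (repeat_query j v R cont) \<le>
    \<delta> + (if answer_towards dir v t1 \<in> R then 0 else q ^ j)
      + (if answer_towards dir v t2 \<in> R then 0 else q ^ j)"
  using R
proof (induction j arbitrary: R)
  case 0
  have "0 \<le> \<delta>"
    using cont by (rule order_trans[rotated]) (simp add: failure_def)
  show ?case
  proof (cases "answer_towards dir v t1 \<in> R \<and> answer_towards dir v t2 \<in> R")
    case True
    with 0 have "R = answer_towards dir v ` {t1, t2}" by auto
    with cont True show ?thesis by simp
  next
    case False
    show ?thesis
      using False \<open>0 \<le> \<delta>\<close> failure_le_1[of "direction_query p dir t1 t2" T "cont R"] by auto
  qed
next
  case (Suc j)
  let ?F = "failure (direction_query p dir t1 t2) T"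
  let ?a = "answer_towards dir v t1" and ?b = "answer_towards dir v t2"
  let ?g = "\<lambda>R j. \<delta> + (if ?a \<in> R then 0 else q ^ j) + (if ?b \<in> R then 0 else q ^ j)"
  have q0: "0 \<le> q ^ j" using p q by simp
  have mono: "p * q ^ j \<le> q * q ^ j" "(1 - p) * q ^ j \<le> q * q ^ j"
    using q q0 by (auto intro: mult_right_mono)
  have q1: "0 \<le> q * q ^ j" using p q q0 by simp
  have "?F (repeat_query (Suc j) v R cont) =
      p * ?F (repeat_query j v (insert ?a R) cont) + (1 - p) * ?F (repeat_query j v (insert ?b R) cont)"
    using p by (simp add: failure_Query)
  also have "\<dots> \<le> p * ?g (insert ?a R) j + (1 - p) * ?g (insert ?b R) j"
    using p Suc.prems by (intro add_mono mult_left_mono Suc.IH) auto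
  \<comment> \<open>A query directing to \<open>t1\<close> removes the \<open>?a\<close> term, so
    that term survives with weight at most \<open>1 - p\<close>, and
    \<open>(1 - p) * q ^ j \<le> q ^ Suc j\<close>. The \<open>?b\<close> term is symmetric, with
    weight \<open>p\<close>.\<close>
  also have "\<dots> \<le> ?g R (Suc j)"
    using mono q1 by (auto simp: algebra_simps)
  finally show ?case .
qed

section \<open>Centroid search\<close>

text \<open>In a tree, \<open>r = Some u\<close> gives the component behind \<open>u\<close> after
  deleting \<open>v\<close>, and \<open>r = None\<close> gives \<open>v\<close> itself.\<close>

definition answer_class ::
    "'v set \<Rightarrow> ('v \<Rightarrow> 'v \<Rightarrow> 'v) \<Rightarrow> 'v \<Rightarrow> 'v option \<Rightarrow> 'v set" where
  "answer_class V dir v r = {t \<in> V. answer_towards dir v t = r}"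

text \<open>Isolates what the search uses of the tree, free of weights and distances. The essential
  property is \<open>opposite\<close>: an edge splits the vertices into two complementary
  branches.\<close>

locale direction_tree =
  fixes V :: "'v set" and E :: "('v \<times> 'v) set" and dir :: "'v \<Rightarrow> 'v \<Rightarrow> 'v"
  assumes finite_V: "finite V"
    and arcs_V: "E \<subseteq> V \<times> V"
    and dir_arc: "\<And>v t. v \<in> V \<Longrightarrow> t \<in> V \<Longrightarrow> t \<noteq> v \<Longrightarrow> (v, dir v t) \<in> E"
    and opposite: "\<And>v u. (v, u) \<in> E \<Longrightarrow>
      answer_class V dir u (Some v) = V - answer_class V dir v (Some u)"
begin

abbreviation branch where "branch \<equiv> answer_class V dir"

text \<open>A centroid relative to the candidate set \<open>A\<close>; \<open>w\<close> may lie
  outside \<open>A\<close>.\<close>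

definition centroid :: "'v set \<Rightarrow> 'v \<Rightarrow> bool" where
  "centroid A w \<longleftrightarrow> (\<forall>x. 2 * card (A \<inter> branch w (Some x)) \<le> card A)"

lemma branch_V: "branch v r \<subseteq> V"
  by (auto simp: answer_class_def)

lemma finite_branch: "finite (branch v r)"
  using branch_V finite_V by (rule finite_subset)

lemma branch_None: "branch v None \<subseteq> {v}"
  by (auto simp: answer_class_def answer_towards_def split: if_splits)

lemma branch_arc: "v \<in> V \<Longrightarrow> t \<in> branch v (Some u) \<Longrightarrow> (v, u) \<in> E"
  using dir_arc by (auto simp: answer_class_def answer_towards_def split: if_splits)

text \<open>Walk into the heavy branch. If \<open>u\<close> is not a centroid, some branch at
  \<open>u\<close> holds more than half of \<open>A\<close>. It cannot be the one back to
  \<open>v\<close>, which is the complement of a heavy branch, so it lies strictly inside the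
  current branch and the walk ends by induction on branch size. The last arc \<open>(z, w)\<close>
  is returned as well: it records that everything outside the original branch is seen from
  \<open>w\<close> through \<open>z\<close>.\<close>

lemma centroid_in_branch:
  assumes "(v, u) \<in> E" and "A \<subseteq> V" and "card A < 2 * card (A \<inter> branch v (Some u))"
  obtains z w where "(z, w) \<in> E" "branch z (Some w) \<subseteq> branch v (Some u)" "centroid A w"
proof -
  have "\<exists>z w. (z, w) \<in> E \<and> branch z (Some w) \<subseteq> branch v (Some u) \<and> centroid A w"
    using assms(1,3)
  proof (induction "card (branch v (Some u))" arbitrary: v u rule: less_induct)
    case less
    show ?case
    proof (cases "centroid A u")
      case False
      then obtain x where x: "card A < 2 * card (A \<inter> branch u (Some x))"
        by (auto simp: centroid_def not_le)
      have finA: "finite A" using assms(2) finite_V finite_subset by blast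
      have uV: "u \<in> V" using less.prems(1) arcs_V by auto
      have "A \<inter> branch u (Some x) \<noteq> {}" using x by auto
      then have ux: "(u, x) \<in> E" using branch_arc uV by blast
      have "x \<noteq> v"
      proof
        assume "x = v"
        then have "A \<inter> branch u (Some x) = A - A \<inter> branch v (Some u)"
          using opposite[OF less.prems(1)] assms(2) by auto
        then have "card (A \<inter> branch u (Some x)) = card A - card (A \<inter> branch v (Some u))"
          using finA by (simp add: card_Diff_subset)
        with x less.prems(2) show False by linarith
      qed
      then have "branch u (Some x) \<inter> branch u (Some v) = {}"
        by (auto simp: answer_class_def)
      then have sub: "branch u (Some x) \<subseteq> branch v (Some u)"
        using opposite[OF less.prems(1)] by (auto simp: answer_class_def)
      \<comment> \<open>The vertex \<open>u\<close> witnesses that the inclusion is proper.\<close>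
      have "u \<notin> branch u (Some y)" for y
        by (simp add: answer_class_def answer_towards_def)
      moreover from this have "u \<in> branch v (Some u)"
        using opposite[OF less.prems(1)] uV by auto
      ultimately have "branch u (Some x) \<subset> branch v (Some u)" using sub by blast
      moreover have "finite (branch v (Some u))" by (rule finite_branch)
      ultimately have "card (branch u (Some x)) < card (branch v (Some u))"
        by (rule psubset_card_mono[rotated])
      from less.hyps[OF this ux x] sub show ?thesis by blast
    qed (use less.prems(1) in blast)
  qed
  with that show thesis by blast
qed

lemma ex_centroid:
  assumes "A \<subseteq> V" and "V \<noteq> {}"
  obtains w where "w \<in> V" "centroid A w"
proof -
  obtain v where v: "v \<in> V" using assms(2) by blast
  show thesis
  proof (cases "centroid A v")
    case False
    then obtain u where u: "card A < 2 * card (A \<inter> branch v (Some u))"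
      by (auto simp: centroid_def not_le)
    then have "A \<inter> branch v (Some u) \<noteq> {}" by auto
    then have "(v, u) \<in> E" using branch_arc v by blast
    with u assms(1) that arcs_V show thesis by (blast elim: centroid_in_branch)
  qed (use v that in blast)
qed

text \<open>The class of \<open>None\<close> has at most one element, which fits under
  \<open>2 ^ k\<close> even for \<open>k = 0\<close>; every other class is halved by the centroid
  property.\<close>

lemma centroid_card:
  assumes "centroid A w" and "A \<subseteq> V" and "card A \<le> 2 ^ Suc k"
  shows "card (A \<inter> branch w r) \<le> 2 ^ k"
proof (cases r)
  case None
  have "card (A \<inter> branch w r) \<le> card {w}"
    using branch_None None by (intro card_mono) auto
  also have "\<dots> \<le> 2 ^ k" by simp
  finally show ?thesis .
next
  case (Some x)
  with assms(1) have "2 * card (A \<inter> branch w r) \<le> card A"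
    by (simp add: centroid_def)
  with assms(3) show ?thesis by simp
qed

end

section \<open>Search by noisy set queries\<close>

locale noisy_direction_tree = direction_tree +
  fixes p q :: real and K :: nat
  assumes p: "0 < p" "p < 1" and q: "p \<le> q" "1 - p \<le> q"
begin

abbreviation ans where "ans \<equiv> answer_towards dir"

definition fails :: "'a \<Rightarrow> 'a \<Rightarrow> 'a strategy \<Rightarrow> real" where
  "fails t1 t2 = failure (direction_query p dir t1 t2) {t1, t2}"

text \<open>The error of one simulated set query: each of the two answers is missed in all
  \<open>K\<close> rounds with probability at most \<open>q ^ K\<close>.\<close>

definition \<epsilon> where "\<epsilon> = 2 * q ^ K"

definition ask_all :: "'a \<Rightarrow> ('a option set \<Rightarrow> 'a strategy) \<Rightarrow> 'a strategy" where
  "ask_all v = repeat_query K v {}"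

lemma eps_nonneg: "0 \<le> \<epsilon>"
  using p q by (simp add: \<epsilon>_def)

lemma fails_ask_all:
  assumes "fails t1 t2 (cont (ans v ` {t1, t2})) \<le> \<delta>"
  shows "fails t1 t2 (ask_all v cont) \<le> \<delta> + \<epsilon>"
  using failure_repeat_query[of p q dir t1 t2 "{t1, t2}" cont v \<delta> "{}" K] assms p q
  by (simp add: fails_def \<epsilon>_def ask_all_def)

text \<open>\<open>F\<close> is a subroutine in continuation-passing style: it narrows a target known to lie in \<open>A\<close>
  down to one vertex, provided that the other target lies in \<open>B\<close>.\<close>

definition locates :: "nat \<Rightarrow> 'a set \<Rightarrow> 'a set \<Rightarrow> (('a \<Rightarrow> 'a strategy) \<Rightarrow> 'a strategy) \<Rightarrow> bool" where
  "locates k A B F \<longleftrightarrow>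
     (\<forall>\<kappa> m. (\<forall>x. queries_within V (\<kappa> x) m) \<longrightarrow> queries_within V (F \<kappa>) (k * K + m)) \<and>
     (\<forall>\<kappa> \<delta> t1 t2. \<forall>a\<in>A. \<forall>b\<in>B. {t1, t2} = {a, b} \<and> fails t1 t2 (\<kappa> a) \<le> \<delta> \<longrightarrow>
        fails t1 t2 (F \<kappa>) \<le> \<delta> + real k * \<epsilon>)"

lemma locates_queries:
  assumes "locates k A B F" and "\<And>x. queries_within V (\<kappa> x) m"
  shows "queries_within V (F \<kappa>) (k * K + m)"
  using assms unfolding locates_def by simp

lemma locates_fails:
  assumes "locates k A B F" and "a \<in> A" and "b \<in> B" and "{t1, t2} = {a, b}"
    and "fails t1 t2 (\<kappa> a) \<le> \<delta>"
  shows "fails t1 t2 (F \<kappa>) \<le> \<delta> + real k * \<epsilon>"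
  using assms(1)[unfolded locates_def, THEN conjunct2, rule_format, OF assms(2,3)] assms(4,5) by simp

text \<open>The only possible candidate is passed on without a query. For empty \<open>A\<close> the
  guarantee is vacuous and \<open>x\<close> is a dummy, which is how empty classes are handled
  below.\<close>

lemma ex_locates_singleton:
  assumes "A \<subseteq> {x}"
  shows "\<exists>F. locates k A B F"
proof (rule exI[of _ "\<lambda>\<kappa>. \<kappa> x"], unfold locates_def, intro conjI allI ballI impI)
  fix \<kappa> :: "'a \<Rightarrow> 'a strategy" and m assume "\<forall>x. queries_within V (\<kappa> x) m"
  then show "queries_within V (\<kappa> x) (k * K + m)" by (meson le_add2 queries_within_mono)
next
  fix \<kappa> :: "'a \<Rightarrow> 'a strategy" and \<delta> t1 t2 a b
  assume "a \<in> A" and "{t1, t2} = {a, b} \<and> fails t1 t2 (\<kappa> a) \<le> \<delta>"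
  then show "fails t1 t2 (\<kappa> x) \<le> \<delta> + real k * \<epsilon>"
    using assms eps_nonneg by (auto intro: add_increasing2)
qed

text \<open>Induction on \<open>k\<close>, with one set query per level at a centroid
  \<open>w\<close> of the remaining candidates, chosen inside the branch. The other target then
  contributes the known answer \<open>Some z\<close>, so the answer set reveals the class at
  \<open>w\<close> of the target sought.\<close>

lemma ex_locates:
  assumes "(v, u) \<in> E" and "A \<subseteq> branch v (Some u)" and "card A \<le> 2 ^ k"
  shows "\<exists>F. locates k A (V - branch v (Some u)) F"
  using assms(2,3)
proof (induction k arbitrary: A)
  case 0
  have "finite A" using finite_subset[OF subset_trans[OF 0(1) branch_V] finite_V] .
  with 0(2) obtain x where x: "A \<subseteq> {x}" using card_le_1_subset_singleton[of A] by auto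
  from x show ?case by (rule ex_locates_singleton)
next
  case (Suc k)
  have AV: "A \<subseteq> V" using Suc.prems(1) by (auto simp: answer_class_def)
  show ?case
  \<comment> \<open>Empty \<open>A\<close> is split off because the strict majority required by
    \<open>centroid_in_branch\<close> fails for it.\<close>
  proof (cases "A = {}")
    case True
    then have "A \<subseteq> {v}" by simp
    then show ?thesis by (rule ex_locates_singleton)
  next
    case False
    have "card A < 2 * card (A \<inter> branch v (Some u))"
    proof -
      have "A \<inter> branch v (Some u) = A" using Suc.prems(1) by blast
      moreover have "0 < card A" using False AV finite_V by (meson card_gt_0_iff finite_subset)
      ultimately show ?thesis by simp
    qed
    from centroid_in_branch[OF assms(1) AV this] obtain z w
      where zw: "(z, w) \<in> E" "branch z (Some w) \<subseteq> branch v (Some u)" and w: "centroid A w"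
      by blast
    have wV: "w \<in> V" using zw(1) arcs_V by auto
    define A' where "A' R = {t \<in> A. {ans w t, Some z} = R}" for R
    have "\<exists>F. locates k (A' R) (V - branch v (Some u)) F" for R
    proof (rule Suc.IH)
      show "A' R \<subseteq> branch v (Some u)" using Suc.prems(1) by (auto simp: A'_def)
      \<comment> \<open>A set \<open>{r, Some z}\<close> determines \<open>r\<close>, also when
        \<open>r = Some z\<close>, so all candidates compatible with \<open>R\<close> lie in a
        single class at \<open>w\<close>.\<close>
      have "\<exists>r. A' R \<subseteq> A \<inter> branch w r"
      proof (cases "A' R = {}")
        case False
        then obtain t where "{ans w t, Some z} = R" by (auto simp: A'_def)
        then have "A' R \<subseteq> A \<inter> branch w (ans w t)"
          using AV by (auto simp: A'_def answer_class_def doubleton_eq_iff)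
        then show ?thesis by (intro exI)
      qed simp
      then obtain r where r: "A' R \<subseteq> A \<inter> branch w r" ..
      have "card (A' R) \<le> card (A \<inter> branch w r)"
        by (rule card_mono[OF finite_Int[OF disjI2[OF finite_branch]] r])
      also have "\<dots> \<le> 2 ^ k" using centroid_card[OF w AV Suc.prems(2)] .
      finally show "card (A' R) \<le> 2 ^ k" .
    qed
    then obtain F where F: "locates k (A' R) (V - branch v (Some u)) (F R)" for R by metis
    have "locates (Suc k) A (V - branch v (Some u)) (\<lambda>\<kappa>. ask_all w (\<lambda>R. F R \<kappa>))"
      unfolding locates_def
    proof (intro conjI allI ballI impI)
      fix \<kappa> :: "'a \<Rightarrow> 'a strategy" and m assume "\<forall>x. queries_within V (\<kappa> x) m"
      then have "queries_within V (F R \<kappa>) (k * K + m)" for R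
        by (intro locates_queries[OF F]) simp
      from queries_within_repeat_query[of w V "\<lambda>R. F R \<kappa>", OF wV this, of K "{}"]
      show "queries_within V (ask_all w (\<lambda>R. F R \<kappa>)) (Suc k * K + m)"
        by (simp add: ask_all_def add.assoc)
    next
      fix \<kappa> :: "'a \<Rightarrow> 'a strategy" and \<delta> t1 t2 a b
      assume a: "a \<in> A" and b: "b \<in> V - branch v (Some u)"
        and t: "{t1, t2} = {a, b} \<and> fails t1 t2 (\<kappa> a) \<le> \<delta>"
      \<comment> \<open>\<open>w\<close> was reached through \<open>z\<close> inside the branch, so the other target lies behind \<open>z\<close>.\<close>
      have "b \<in> branch w (Some z)" using opposite[OF zw(1)] b zw(2) by auto
      then have "ans w ` {t1, t2} = {ans w a, Some z}" using t by (auto simp: answer_class_def)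
      with a have "a \<in> A' (ans w ` {t1, t2})" by (simp add: A'_def)
      then have "fails t1 t2 (F (ans w ` {t1, t2}) \<kappa>) \<le> \<delta> + real k * \<epsilon>"
        using t by (intro locates_fails[OF F _ b]) auto
      from fails_ask_all[of t1 t2 "\<lambda>R. F R \<kappa>", OF this]
      show "fails t1 t2 (ask_all w (\<lambda>R. F R \<kappa>)) \<le> \<delta> + real (Suc k) * \<epsilon>"
        by (simp add: algebra_simps)
    qed
    then show ?thesis by (rule exI[of _ "\<lambda>\<kappa>. ask_all w (\<lambda>R. F R \<kappa>)"])
  qed
qed

text \<open>Makes \<open>ex_locates\<close> uniform in the answer \<open>r\<close>:
  \<open>None\<close> leaves only \<open>v\<close>, and an empty class, where \<open>r\<close> may
  name no neighbor, is trivial.\<close>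

lemma ex_locates_branch:
  assumes "v \<in> V" and "A \<subseteq> V" and "card (A \<inter> branch v r) \<le> 2 ^ k"
  shows "\<exists>F. locates k (A \<inter> branch v r) (V - branch v r) F"
proof (cases r)
  case None
  then have "A \<inter> branch v r \<subseteq> {v}" using branch_None by blast
  then show ?thesis by (rule ex_locates_singleton)
next
  case (Some u)
  show ?thesis
  proof (cases "branch v r = {}")
    case True
    then have "A \<inter> branch v r \<subseteq> {v}" by simp
    then show ?thesis by (rule ex_locates_singleton)
  next
    case False
    then have "(v, u) \<in> E" using branch_arc assms(1) Some by blast
    from ex_locates[OF this, of "A \<inter> branch v r" k] Some assms(3) show ?thesis by simp
  qed
qed

text \<open>One set query at a centroid either keeps the targets in a common class, to be treated
  with \<open>2 * k\<close> further set queries, or separates them, which leaves two searches of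
  \<open>k\<close> set queries each. Either way the cost is \<open>2 * k + 1\<close>, within the
  allowance \<open>2 * Suc k\<close>.\<close>

lemma ex_finds_both:
  assumes "V \<noteq> {}" and "C \<subseteq> V" and "card C \<le> 2 ^ k"
  shows "\<exists>s. queries_within V s (2 * k * K) \<and>
    (\<forall>t1\<in>C. \<forall>t2\<in>C. fails t1 t2 s \<le> 2 * real k * \<epsilon>)"
  using assms(2,3)
proof (induction k arbitrary: C)
  case 0
  have "finite C" using finite_subset[OF 0(1) finite_V] .
  with 0(2) obtain x where x: "C \<subseteq> {x}" using card_le_1_subset_singleton[of C] by auto
  from x have "\<forall>t1\<in>C. \<forall>t2\<in>C. fails t1 t2 (Output {x}) \<le> 2 * real 0 * \<epsilon>"
    by (auto simp: fails_def)
  then show ?case by (intro exI[of _ "Output {x}"]) simp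
next
  case (Suc k)
  obtain v where v: "v \<in> V" "centroid C v" using ex_centroid[OF Suc.prems(1) assms(1)] .
  define C' where "C' r = C \<inter> branch v r" for r
  have C'V: "C' r \<subseteq> V" for r using Suc.prems(1) by (auto simp: C'_def)
  have card_C': "card (C' r) \<le> 2 ^ k" for r
    unfolding C'_def using centroid_card[OF v(2) Suc.prems] .
  have in_C': "t \<in> C' (ans v t)" if "t \<in> C" for t
    using that Suc.prems(1) by (auto simp: C'_def answer_class_def)
  have "\<exists>s. queries_within V s (2 * k * K) \<and>
      (\<forall>t1\<in>C. \<forall>t2\<in>C. ans v ` {t1, t2} = R \<longrightarrow> fails t1 t2 s \<le> 2 * real k * \<epsilon>)" for R
  proof -
    consider r where "R = {r}" | r r' where "R = {r, r'}" "r \<noteq> r'" | "\<nexists>r r'. R = {r, r'}"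
      by (metis insert_absorb2)
    then show ?thesis
    proof cases
      case 1
      from Suc.IH[OF C'V card_C', of r] obtain s where
        s: "queries_within V s (2 * k * K)"
          "\<forall>t1\<in>C' r. \<forall>t2\<in>C' r. fails t1 t2 s \<le> 2 * real k * \<epsilon>" by blast
      have "fails t1 t2 s \<le> 2 * real k * \<epsilon>" if "t1 \<in> C" "t2 \<in> C" "ans v ` {t1, t2} = R" for t1 t2
      proof -
        have "ans v t1 = r" "ans v t2 = r" using that(3) 1 by simp_all
        with in_C'[OF that(1)] in_C'[OF that(2)] s(2) show ?thesis by simp
      qed
      with s(1) show ?thesis by blast
    next
      case 2
      obtain F where F: "locates k (C' r'') (V - branch v r'') (F r'')" for r''
        using ex_locates_branch[OF v(1) Suc.prems(1) card_C'[unfolded C'_def], folded C'_def] by metis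
      \<comment> \<open>The two searches are nested: the continuation of the first runs the second.
        Each target lies outside the branch in which the other is sought.\<close>
      define s where "s = F r (\<lambda>a. F r' (\<lambda>b. Output {a, b}))"
      have "queries_within V (F r' (\<lambda>b. Output {a, b})) (k * K + 0)" for a
        by (rule locates_queries[OF F]) simp
      then have "queries_within V s (k * K + (k * K + 0))"
        unfolding s_def by (rule locates_queries[OF F])
      then have "queries_within V s (2 * k * K)" by (simp add: mult_2 add_mult_distrib)
      moreover have "fails t1 t2 s \<le> 2 * real k * \<epsilon>"
        if t: "t1 \<in> C" "t2 \<in> C" "ans v ` {t1, t2} = R" for t1 t2
      proof -
        have "{ans v t1, ans v t2} = {r, r'}" using t(3) 2(1) by simp
        then have "ans v t1 = r \<and> ans v t2 = r' \<or> ans v t1 = r' \<and> ans v t2 = r"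
          by (simp add: doubleton_eq_iff)
        \<comment> \<open>\<open>R\<close> fixes the two answers only up to order, so
          \<open>a\<close> names whichever target answers \<open>r\<close>.\<close>
        then obtain a b where ab: "{t1, t2} = {a, b}" "a \<in> C" "b \<in> C" "ans v a = r" "ans v b = r'"
          using t(1,2) insert_commute[of t1 t2 "{}"] by metis
        have a: "a \<in> C' r" "a \<in> V - branch v r'" and b: "b \<in> C' r'" "b \<in> V - branch v r"
          using ab 2(2) Suc.prems(1) by (auto simp: C'_def answer_class_def)
        have "fails t1 t2 (Output {a, b}) \<le> 0" using ab(1) by (simp add: fails_def)
        then have "fails t1 t2 (F r' (\<lambda>b. Output {a, b})) \<le> 0 + real k * \<epsilon>"
          using ab(1) by (intro locates_fails[OF F b(1) a(2)]) auto
        then have "fails t1 t2 s \<le> (0 + real k * \<epsilon>) + real k * \<epsilon>"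
          unfolding s_def by (rule locates_fails[OF F a(1) b(2) ab(1)])
        then show ?thesis by simp
      qed
      ultimately show ?thesis by blast
    next
      \<comment> \<open>No pair of targets produces such an \<open>R\<close>; the output is a
        placeholder.\<close>
      case 3
      then have "ans v ` {t1, t2} \<noteq> R" for t1 t2 by (metis image_insert image_empty)
      then show ?thesis by (intro exI[of _ "Output {}"]) simp
    qed
  qed
  then obtain s where s: "\<And>R. queries_within V (s R) (2 * k * K)"
    "\<And>t1 t2. t1 \<in> C \<Longrightarrow> t2 \<in> C \<Longrightarrow> fails t1 t2 (s (ans v ` {t1, t2})) \<le> 2 * real k * \<epsilon>"
    by metis
  have "queries_within V (ask_all v s) (K + 2 * k * K)"
    unfolding ask_all_def using v(1) s(1) by (rule queries_within_repeat_query)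
  then have "queries_within V (ask_all v s) (2 * Suc k * K)"
    by (rule queries_within_mono) simp
  moreover have "fails t1 t2 (ask_all v s) \<le> 2 * real (Suc k) * \<epsilon>" if "t1 \<in> C" "t2 \<in> C" for t1 t2
    using fails_ask_all[of t1 t2 s, OF s(2)[OF that]] eps_nonneg by (simp add: algebra_simps)
  ultimately show ?case by blast
qed

end

section \<open>Directions in weighted trees\<close>

locale weighted_tree = pair_graph G for G :: "'v pair_pre_digraph" +
  fixes w :: "'v \<times> 'v \<Rightarrow> real"
  assumes tree: "undirected_tree G" and weights: "pos_edge_weights G w"
begin

lemma weight_pos: "e \<in> parcs G \<Longrightarrow> 0 < w e"
  using weights by (cases e) (auto simp: pos_edge_weights_def)

lemma weight_sym: "(u, v) \<in> parcs G \<Longrightarrow> w (v, u) = w (u, v)"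
  using weights by (auto simp: pos_edge_weights_def)

lemma ex_awalk:
  assumes "u \<in> pverts G" and "v \<in> pverts G"
  shows "\<exists>p. awalk u p v"
proof -
  have "strongly_connected (mk_symmetric (with_proj G))"
    using tree by (simp add: undirected_tree_def connected_def)
  then have "u \<rightarrow>\<^sup>*\<^bsub>mk_symmetric (with_proj G)\<^esub> v"
    using assms by (simp add: strongly_connected_def)
  then have "u \<rightarrow>\<^sup>*\<^bsub>with_proj G\<^esub> v"
    using reachable_mk_symmetric_eq pair_sym_arcs by blast
  then show ?thesis by (simp add: reachable_awalk)
qed

text \<open>A weight-free form of direction: \<open>u\<close> is the neighbor of \<open>v\<close>
  through which \<open>t\<close> is reached without returning to \<open>v\<close>.\<close>

definition leads_to :: "'v \<Rightarrow> 'v \<Rightarrow> 'v \<Rightarrow> bool" where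
  "leads_to v u t \<longleftrightarrow> (v, u) \<in> parcs G \<and> (\<exists>p. awalk u p t \<and> v \<notin> set (awalk_verts u p))"

text \<open>Two such neighbors are joined, by way of \<open>t\<close>, by a walk avoiding
  \<open>v\<close>. Shortened to a path and closed up through \<open>v\<close>, it is a
  cycle.\<close>

lemma leads_to_unique:
  assumes "leads_to v u t" and "leads_to v u' t"
  shows "u = u'"
proof (rule ccontr)
  assume "u \<noteq> u'"
  from assms obtain p p' where arcs: "(v, u) \<in> parcs G" "(v, u') \<in> parcs G"
    and p: "awalk u p t" "v \<notin> set (awalk_verts u p)"
    and p': "awalk u' p' t" "v \<notin> set (awalk_verts u' p')"
    by (auto simp: leads_to_def)
  let ?r = "p @ rev_path p'"
  have r: "awalk u ?r u'" using p(1) p'(1) by (auto intro: awalk_appendI)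
  have v: "v \<notin> set (awalk_verts u ?r)"
    using set_awalk_verts_append[OF p(1), of "rev_path p'" u'] p p' awalk_verts_rev_path[OF p'(1)]
    by simp
  define q where "q = awalk_to_apath ?r"
  have q: "apath u q u'" and sub: "set q \<subseteq> set ?r"
    using apath_awalk_to_apath[OF r] awalk_to_apath_subset[OF r] by (auto simp: q_def)
  then have qw: "awalk u q u'" and dist: "distinct (awalk_verts u q)"
    by (auto simp: apath_def)
  have vq: "v \<notin> set (awalk_verts u q)"
    using v sub unfolding set_awalk_verts[OF r] set_awalk_verts[OF qw] by auto
  \<comment> \<open>A nonempty \<open>q\<close> gives the cycle at least three arcs, which excludes
    the two arcs of one undirected edge.\<close>
  have "q \<noteq> []" using qw \<open>u \<noteq> u'\<close> by (auto simp: awalk_Nil_iff)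
  let ?c = "(v, u) # q @ [(u', v)]"
  have sym: "(u', v) \<in> parcs G" using arcs(2) by (rule arcs_symmetric)
  then have step: "awalk u' [(u', v)] v" by (auto simp: awalk_simps dest: in_arcsD2)
  then have c: "awalk v ?c v"
    using arcs(1) qw by (auto simp: awalk_Cons_iff)
  have "awalk_verts u (q @ [(u', v)]) = awalk_verts u q @ [v]"
    using awalk_verts_append[of u q "[(u', v)]" v] qw step by auto
  then have "distinct (tl (awalk_verts v ?c))" using dist vq by simp
  with c have "cycle ?c" unfolding cycle_def by blast
  moreover have "3 \<le> length ?c" using \<open>q \<noteq> []\<close> by (cases q) auto
  ultimately show False using tree unfolding undirected_tree_def by blast
qed

text \<open>A connecting walk bounds the distance above, positive weights bound it below. Finiteness
  permits cancellation in equations between extended reals.\<close>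

lemma \<mu>_finite:
  assumes "u \<in> pverts G" and "v \<in> pverts G"
  obtains r where "\<mu> w u v = ereal r"
proof -
  obtain p where "awalk u p v" using ex_awalk[OF assms] by blast
  then have "\<mu> w u v \<noteq> \<infinity>" using min_cost_le_walk_cost[of u p v w] by auto
  moreover have "0 \<le> \<mu> w u v"
    unfolding \<mu>_def using pos_cost_pos_awalk_cost[of _ _ _ w] weight_pos
    by (intro INF_greatest) (auto simp: less_imp_le)
  then have "\<mu> w u v \<noteq> - \<infinity>" by auto
  ultimately show thesis using that by (cases "\<mu> w u v") auto
qed

text \<open>If every walk from \<open>u\<close> to \<open>t\<close> passed through \<open>v\<close>, then \<open>t\<close> would be at least as far from \<open>u\<close>
  as from \<open>v\<close>.\<close>

lemma leads_to_if_nbrs_via: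
  assumes vu: "(v, u) \<in> parcs G" and t: "t \<in> nbrs_via G w v u"
  shows "leads_to v u t"
proof (rule ccontr)
  assume not: "\<not> leads_to v u t"
  have tV: "t \<in> pverts G" and eq: "\<mu> w v t = ereal (w (v, u)) + \<mu> w u t"
    using t by (auto simp: nbrs_via_def sp_dist_def)
  have "\<mu> w v t \<le> \<mu> w u t"
    unfolding \<mu>_def[of w u t]
  proof (rule INF_greatest)
    fix p assume "p \<in> {p. awalk u p t}"
    then have p: "awalk u p t" by simp
    with not vu have "v \<in> set (awalk_verts u p)" by (auto simp: leads_to_def)
    then obtain q r where pqr: "p = q @ r" "awalk u q v" "awalk v r t"
      using awalk_decomp[OF p] by blast
    have "\<mu> w v t \<le> awalk_cost w r" using min_cost_le_walk_cost[OF pqr(3)] .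
    also have "0 \<le> awalk_cost w q"
      by (rule pos_cost_pos_awalk_cost[OF pqr(2)]) (auto intro: less_imp_le weight_pos)
    then have "ereal (awalk_cost w r) \<le> awalk_cost w p" by (simp add: pqr(1))
    finally show "\<mu> w v t \<le> ereal (awalk_cost w p)" .
  qed
  moreover obtain r where "\<mu> w u t = ereal r" using \<mu>_finite tV vu by (blast dest: in_arcsD2)
  ultimately show False using eq weight_pos[OF vu] by simp
qed

text \<open>Adding the two distance equations would give \<open>w (v, u) + w (u, v) = 0\<close>,
  against positivity.\<close>

lemma not_nbrs_via_both:
  assumes "(v, u) \<in> parcs G" and "t \<in> nbrs_via G w v u"
  shows "t \<notin> nbrs_via G w u v"
proof
  assume "t \<in> nbrs_via G w u v"
  with assms(2) have eq: "\<mu> w v t = ereal (w (v, u)) + \<mu> w u t" "\<mu> w u t = ereal (w (u, v)) + \<mu> w v t"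
    and "t \<in> pverts G"
    by (auto simp: nbrs_via_def sp_dist_def)
  then obtain r r' where "\<mu> w v t = ereal r" "\<mu> w u t = ereal r'"
    using \<mu>_finite assms(1) in_arcsD1 in_arcsD2 by metis
  with eq weight_pos[OF assms(1)] weight_sym[OF assms(1)] show False by simp
qed

end

section \<open>Branches seen by a direction function\<close>

locale tree_oracle = weighted_tree +
  fixes dir :: "'a \<Rightarrow> 'a \<Rightarrow> 'a"
  assumes dir: "direction_fun G w dir"
begin

lemma
  assumes "v \<in> pverts G" and "t \<in> pverts G" and "t \<noteq> v"
  shows dir_arc: "(v, dir v t) \<in> parcs G"
    and dir_via: "t \<in> nbrs_via G w v (dir v t)"
    and dir_leads_to: "leads_to v (dir v t) t"
proof -
  show "(v, dir v t) \<in> parcs G" "t \<in> nbrs_via G w v (dir v t)"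
    using dir assms by (auto simp: direction_fun_def nbrs_def)
  then show "leads_to v (dir v t) t" by (rule leads_to_if_nbrs_via)
qed

lemma dir_eq:
  assumes "leads_to v u t" and "t \<in> pverts G" and "t \<noteq> v"
  shows "dir v t = u"
proof -
  have "v \<in> pverts G" using assms(1) in_arcsD1 by (auto simp: leads_to_def)
  from leads_to_unique[OF dir_leads_to[OF this assms(2,3)] assms(1)] show ?thesis .
qed

lemma leads_to_refl: "(v, u) \<in> parcs G \<Longrightarrow> leads_to v u u"
  using pair_no_loops[of "(v, u)"]
  by (auto simp: leads_to_def awalk_Nil_iff dest: in_arcsD2 intro!: exI[of _ "[]"])

text \<open>From \<open>u\<close>, the target is reached by stepping to \<open>v\<close> and then
  following the walk that avoids \<open>v\<close> from \<open>dir v t\<close>.\<close>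

lemma leads_to_back:
  assumes vu: "(v, u) \<in> parcs G" and t: "t \<in> pverts G" "t \<noteq> v" and ne: "dir v t \<noteq> u"
  shows "leads_to u v t \<and> t \<noteq> u"
proof -
  let ?x = "dir v t"
  from vu have vV: "v \<in> pverts G" by (rule in_arcsD1)
  from dir_leads_to[OF vV t] obtain p where vx: "(v, ?x) \<in> parcs G" and p: "awalk ?x p t"
    "v \<notin> set (awalk_verts ?x p)"
    by (auto simp: leads_to_def)
  \<comment> \<open>If that walk met \<open>u\<close>, its initial piece would make
    \<open>dir v t\<close> lead from \<open>v\<close> to \<open>u\<close>; but \<open>u\<close>
    itself does so, and the leading neighbor is unique.\<close>
  have u: "u \<notin> set (awalk_verts ?x p)"
  proof
    assume "u \<in> set (awalk_verts ?x p)"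
    then obtain q r where qr: "p = q @ r" "awalk ?x q u" "awalk u r t"
      using awalk_decomp[OF p(1)] by blast
    have "v \<notin> set (awalk_verts ?x q)"
      using p(2) set_awalk_verts_append[OF qr(2,3)] qr(1) by auto
    with vx qr(2) have "leads_to v ?x u" by (auto simp: leads_to_def)
    from leads_to_unique[OF this leads_to_refl[OF vu]] ne show False by simp
  qed
  have "awalk v ((v, ?x) # p) t" using p(1) vx vV by (auto simp: awalk_Cons_iff)
  moreover have "u \<notin> set (awalk_verts v ((v, ?x) # p))"
    using u pair_no_loops[OF vu] by auto
  ultimately have "leads_to u v t"
    using arcs_symmetric[OF vu] unfolding leads_to_def by blast
  moreover have "t \<in> set (awalk_verts ?x p)"
    using p(1) set_awalk_verts_append[OF p(1), of "[]" t] t(1) by (auto simp: awalk_Nil_iff)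
  ultimately show ?thesis using u by blast
qed

text \<open>Disjointness comes from the distances, by \<open>not_nbrs_via_both\<close>; that the two
  branches cover all vertices comes from the walks, by \<open>leads_to_back\<close>.\<close>

lemma opposite_branch:
  assumes vu: "(v, u) \<in> parcs G"
  shows "answer_class (pverts G) dir u (Some v) = pverts G - answer_class (pverts G) dir v (Some u)"
proof (intro equalityI subsetI)
  fix t assume t: "t \<in> answer_class (pverts G) dir u (Some v)"
  then have tu: "t \<in> pverts G" "t \<noteq> u" "dir u t = v"
    by (auto simp: answer_class_def answer_towards_def split: if_splits)
  have "t \<in> nbrs_via G w u v"
    using dir_via[OF in_arcsD2[OF vu] tu(1,2)] tu(3) by simp
  moreover have "t \<in> nbrs_via G w v u" if "t \<in> answer_class (pverts G) dir v (Some u)"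
    using that dir_via[OF in_arcsD1[OF vu], of t] by (auto simp: answer_class_def answer_towards_def split: if_splits)
  ultimately show "t \<in> pverts G - answer_class (pverts G) dir v (Some u)"
    using not_nbrs_via_both[OF vu, of t] tu(1) by blast
next
  fix t assume t: "t \<in> pverts G - answer_class (pverts G) dir v (Some u)"
  have "leads_to u v t \<and> t \<noteq> u"
  proof (cases "t = v")
    case True
    then show ?thesis using leads_to_refl[OF arcs_symmetric[OF vu]] pair_no_loops[OF vu] by auto
  next
    case False
    then have "dir v t \<noteq> u" using t by (auto simp: answer_class_def answer_towards_def)
    with leads_to_back[OF vu] t False show ?thesis by blast
  qed
  with t dir_eq[of u v t] show "t \<in> answer_class (pverts G) dir u (Some v)" by (auto simp: answer_class_def answer_towards_def)
qed

end

sublocale tree_oracle \<subseteq> direction_tree "pverts G" "parcs G" dir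
proof
  show "finite (pverts G)" by (rule pair_finite_verts)
  show "parcs G \<subseteq> pverts G \<times> pverts G" by (auto dest: in_arcsD1 in_arcsD2)
qed (fact dir_arc opposite_branch)+

text \<open>On vertices of the tree the direction is forced by \<open>leads_to\<close>, so all
  direction functions define the same oracle there.\<close>

lemma direction_query_eq:
  assumes "tree_oracle G w dir" and "tree_oracle G w dir'"
    and "t1 \<in> pverts G" and "t2 \<in> pverts G" and "v \<in> pverts G"
  shows "direction_query p dir t1 t2 v = direction_query p dir' t1 t2 v"
proof -
  have "answer_towards dir v t = answer_towards dir' v t" if "t \<in> pverts G" for t
    using tree_oracle.dir_eq[OF assms(1) tree_oracle.dir_leads_to[OF assms(2,5) that] that]
    by (auto simp: answer_towards_def)
  then have "answer_towards dir v (if b then t1 else t2) = answer_towards dir' v (if b then t1 else t2)" for b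
    using assms(3,4) by simp
  then show ?thesis by (simp add: direction_query_def)
qed

text \<open>The strategy has to be fixed before \<open>dir\<close>. It is built from one direction
  function and serves every other, since their runs agree. The factor 4 is \<open>2 * k\<close> set
  queries times the 2 in \<epsilon>.\<close>

lemma ex_strategy:
  fixes p q :: real
  assumes "undirected_tree G" and "pos_edge_weights G w" and card: "card (pverts G) \<le> 2 ^ k"
    and p: "0 < p" "p < 1" and q: "p \<le> q" "1 - p \<le> q"
  shows "\<exists>s. queries_within (pverts G) s (2 * k * K) \<and>
    (\<forall>dir. direction_fun G w dir \<longrightarrow> (\<forall>t1\<in>pverts G. \<forall>t2\<in>pverts G.
       failure (direction_query p dir t1 t2) {t1, t2} s \<le> 4 * real k * q ^ K))"
proof (cases "\<exists>dir. direction_fun G w dir")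
  case False
  then show ?thesis by (intro exI[of _ "Output {}"]) simp
next
  case True
  then obtain dir where dir: "direction_fun G w dir" ..
  have oracles: "tree_oracle G w dir'" if "direction_fun G w dir'" for dir'
    using assms(1,2) that
    by (simp add: tree_oracle_def tree_oracle_axioms_def weighted_tree_def weighted_tree_axioms_def
        undirected_tree_def)
  interpret tree_oracle G w dir using dir by (rule oracles)
  interpret noisy_direction_tree "pverts G" "parcs G" dir p q K
    using p q by unfold_locales
  have "pverts G \<noteq> {}"
    using assms(1) by (simp add: undirected_tree_def connected_def strongly_connected_def)
  from ex_finds_both[OF this order_refl card] obtain s where s: "queries_within (pverts G) s (2 * k * K)"
    and fails: "\<And>t1 t2. t1 \<in> pverts G \<Longrightarrow> t2 \<in> pverts G \<Longrightarrow> fails t1 t2 s \<le> 2 * real k * \<epsilon>"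
    by blast
  have "failure (direction_query p dir' t1 t2) {t1, t2} s \<le> 4 * real k * q ^ K"
    if "direction_fun G w dir'" and t: "t1 \<in> pverts G" "t2 \<in> pverts G" for dir' t1 t2
  proof -
    have "run (direction_query p dir' t1 t2) s = run (direction_query p dir t1 t2) s"
      using s direction_query_eq[OF oracles[OF that(1)] oracles[OF dir] t] by (rule run_cong)
    with fails[OF t] show ?thesis by (simp add: fails_def failure_def \<epsilon>_def)
  qed
  with s show ?thesis by blast
qed

section \<open>Number of rounds and error probability\<close>

lemma prob_output_eq:
  "measure_pmf.prob (run ask s) {(S, vs). S = T} = 1 - failure ask T s"
proof -
  have "{(S, vs). S = T} = UNIV - {x :: 'a set \<times> 'a list. fst x \<noteq> T}" by auto
  then show ?thesis
    using measure_pmf.prob_compl[of "{x. fst x \<noteq> T}" "run ask s"] by (simp add: failure_def)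
qed

text \<open>With \<open>L = log 2 (1 / q)\<close> one has \<open>q = 2 powr - L\<close>, so the
  exponent \<open>4 / L * log 2 x\<close> yields exactly \<open>x powr - 4\<close>; rounding it up
  only decreases the power.\<close>

lemma power_ceiling_le:
  fixes q :: real
  assumes "0 < q" and "q < 1" and "0 < x"
  shows "q ^ nat \<lceil>4 / log 2 (1 / q) * log 2 x\<rceil> \<le> 1 / x ^ 4"
proof -
  define L where "L = log 2 (1 / q)"
  have L: "0 < L" using assms by (simp add: L_def)
  have q: "q = 2 powr - L" using assms by (simp add: L_def log_divide powr_minus)
  have "q ^ nat \<lceil>4 / L * log 2 x\<rceil> = q powr real (nat \<lceil>4 / L * log 2 x\<rceil>)"
    using assms by (simp add: powr_realpow)
  also have "\<dots> \<le> q powr (4 / L * log 2 x)"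
    using assms by (intro powr_mono') (auto intro: real_nat_ceiling_ge)
  also have "\<dots> = (2 powr log 2 x) powr - 4"
    using L by (simp add: q powr_powr mult.commute)
  also have "\<dots> = 1 / x ^ 4"
    using assms powr_realpow[of x 4] by (simp add: powr_minus_divide)
  finally show ?thesis by (simp add: L_def)
qed

theorem theorem5:
  fixes p1 :: real
  assumes "0 < p1" and "p1 < 1"
  shows "\<exists>(alg :: 'v pair_pre_digraph \<Rightarrow> ('v \<times> 'v \<Rightarrow> real) \<Rightarrow> 'v strategy) (q :: nat \<Rightarrow> nat).
    (\<lambda>n. real (q n)) \<in> O(\<lambda>n. (log 2 (real n))\<^sup>2) \<and>
    (\<forall>G w dir t1 t2 n.
       undirected_tree G \<and> card (pverts G) = n \<and> pos_edge_weights G w \<and>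
       direction_fun G w dir \<and> t1 \<in> pverts G \<and> t2 \<in> pverts G \<longrightarrow>
       (\<forall>(S, vs) \<in> set_pmf (run (direction_query p1 dir t1 t2) (alg G w)).
          set vs \<subseteq> pverts G \<and> length vs \<le> q n) \<and>
       measure_pmf.prob (run (direction_query p1 dir t1 t2) (alg G w))
         {(S, vs). S = {t1, t2}} \<ge> (1 - log 2 (real n) / real n)\<^sup>2)"
proof -
  define q where "q = max p1 (1 - p1)"
  have q: "p1 \<le> q" "1 - p1 \<le> q" "0 < q" "q < 1" using assms by (auto simp: q_def)
  \<comment> \<open>Chosen so that \<open>q ^ K n \<le> 1 / n ^ 4\<close>; \<open>k\<close> counts
    the halvings and \<open>K\<close> the repetitions of each query.\<close>
  define c where "c = 4 / log 2 (1 / q)"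
  have c: "0 < c" using q by (simp add: c_def)
  define k where "k n = nat \<lceil>log 2 (real n)\<rceil>" for n :: nat
  define K where "K n = nat \<lceil>c * log 2 (real n)\<rceil>" for n :: nat
  define bound where "bound n = 2 * k n * K n" for n
  define good where "good G w s \<longleftrightarrow>
    queries_within (pverts G) s (bound (card (pverts G))) \<and>
    (\<forall>dir. direction_fun G w dir \<longrightarrow> (\<forall>t1\<in>pverts G. \<forall>t2\<in>pverts G.
       failure (direction_query p1 dir t1 t2) {t1, t2} s
         \<le> 4 * real (k (card (pverts G))) * q ^ K (card (pverts G))))"
    for G and w :: "'v \<times> 'v \<Rightarrow> real" and s
  \<comment> \<open>The choice sees only the weighted graph: \<open>good\<close> quantifies over all
    direction functions and targets.\<close>
  define alg where "alg G w = (SOME s. good G w s)" for G and w :: "'v \<times> 'v \<Rightarrow> real"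
  have log_ge_1: "1 \<le> log 2 (real n)" if "2 \<le> n" for n
    using that by simp
  have le_power_k: "n \<le> 2 ^ k n" if "0 < n" for n
  proof -
    have "real n = 2 powr log 2 (real n)" using that by simp
    also have "\<dots> \<le> 2 powr real (k n)"
      unfolding k_def by (intro powr_mono real_nat_ceiling_ge) simp
    also have "\<dots> = real (2 ^ k n)" by (simp add: powr_realpow)
    finally show ?thesis by simp
  qed
  \<comment> \<open>At \<open>n = 0\<close> this rests on the default value of the logarithm at
    0.\<close>
  have k_le: "k n \<le> n" for n
    unfolding k_def using log2_of_power_le[of n n] less_exp[of n]
    by (cases "n = 0") (auto simp: nat_le_iff ceiling_le_iff less_imp_le log_def)
  have error: "4 * real (k n) * q ^ K n \<le> 1 / real n" if "2 \<le> n" for n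
  proof -
    have "4 \<le> real n ^ 2" using that power_mono[of 2 "real n" 2] by simp
    \<comment> \<open>The factor 4 is absorbed by \<open>n ^ 2\<close>, and \<open>k n\<close> by
      \<open>n\<close>.\<close>
    have "4 * real (k n) * q ^ K n \<le> real n ^ 2 * real n * (1 / real n ^ 4)"
      using that q k_le[of n] \<open>4 \<le> real n ^ 2\<close> power_ceiling_le[of q "real n"]
      by (intro mult_mono) (auto simp: K_def c_def)
    also have "\<dots> = 1 / real n" using that by (simp add: power_numeral_reduce)
    finally show ?thesis .
  qed
  have "(\<lambda>n. real (bound n)) \<in> O(\<lambda>n. (log 2 (real n))\<^sup>2)"
  \<comment> \<open>From \<open>n = 2\<close> on the logarithm \<open>l\<close> is at least 1, so
    the roundings are absorbed: \<open>k n \<le> 2 * l\<close> and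
    \<open>K n \<le> (c + 1) * l\<close>. Doubling the product gives the constant.\<close>
  proof (rule bigoI[where c = "4 * (c + 1)"], rule eventually_sequentiallyI[of 2])
    fix n :: nat assume "2 \<le> n"
    define l where "l = log 2 (real n)"
    have l: "1 \<le> l" unfolding l_def by (rule log_ge_1) fact
    have k: "real (k n) \<le> 2 * l"
      unfolding k_def l_def[symmetric] using l of_int_ceiling_le_add_one[of l] by linarith
    have "real (K n) \<le> c * l + 1"
      using c l of_int_ceiling_le_add_one[of "c * l"] by (simp add: K_def l_def[symmetric])
    also have "\<dots> \<le> (c + 1) * l" using l by (simp add: algebra_simps)
    finally have "real (k n) * real (K n) \<le> 2 * l * ((c + 1) * l)"
      using k l by (intro mult_mono) auto
    then show "norm (real (bound n)) \<le> 4 * (c + 1) * norm ((log 2 (real n))\<^sup>2)"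
      by (simp add: bound_def l_def[symmetric] power2_eq_square algebra_simps)
  qed
  moreover have "(\<forall>(S, vs) \<in> set_pmf (run (direction_query p1 dir t1 t2) (alg G w)).
        set vs \<subseteq> pverts G \<and> length vs \<le> bound n) \<and>
      measure_pmf.prob (run (direction_query p1 dir t1 t2) (alg G w)) {(S, vs). S = {t1, t2}}
        \<ge> (1 - log 2 (real n) / real n)\<^sup>2"
    if G: "undirected_tree G" "card (pverts G) = n" "pos_edge_weights G w"
      "direction_fun G w dir" "t1 \<in> pverts G" "t2 \<in> pverts G"
    for G w dir t1 t2 n
  proof -
    have "finite (pverts G)"
      using G(1) by (simp add: undirected_tree_def pair_fin_digraph.pair_finite_verts pair_graph_def
          pair_digraph_def)
    with G(2,5) have n: "0 < n" using card_gt_0_iff by blast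
    have "\<exists>s. good G w s"
      unfolding good_def bound_def G(2)
      using le_power_k[OF n] G(1,2,3) q assms by (intro ex_strategy) auto
    then have "good G w (alg G w)" unfolding alg_def by (rule someI_ex)
    with G have within: "queries_within (pverts G) (alg G w) (bound n)"
      and fail: "failure (direction_query p1 dir t1 t2) {t1, t2} (alg G w) \<le> 4 * real (k n) * q ^ K n"
      by (auto simp: good_def)
    have "(1 - log 2 (real n) / real n)\<^sup>2 \<le> 1 - 4 * real (k n) * q ^ K n"
    proof (cases "n = 1")
      \<comment> \<open>For a single vertex \<open>log 2 1 = 0\<close> and \<open>k 1 = 0\<close>,
        so both sides equal 1.\<close>
      case True
      then show ?thesis by (simp add: k_def)
    next
      case False
      with n have n2: "2 \<le> n" by simp
      \<comment> \<open>The chain is \<open>(1 - x)\<^sup>2 \<le> 1 - x \<le> 1 - 1 / n\<close>,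
        where \<open>x\<close> lies between \<open>1 / n\<close> and 1; the failure probability is
        at most \<open>1 / n\<close>.\<close>
      define x where "x = log 2 (real n) / real n"
      have "log 2 (real n) \<le> real n" using log2_of_power_le[of n n] less_exp[of n] n by simp
      then have x: "1 / real n \<le> x" "x \<le> 1"
        using log_ge_1[OF n2] n by (auto simp: x_def divide_right_mono)
      then have "0 \<le> x" using order_trans[of 0 "1 / real n" x] by simp
      have "(1 - x)\<^sup>2 \<le> 1 - x"
        using mult_left_le[of "1 - x" "1 - x"] x \<open>0 \<le> x\<close> by (simp add: power2_eq_square)
      with x error[OF n2] show ?thesis unfolding x_def by linarith
    qed
    with fail have "(1 - log 2 (real n) / real n)\<^sup>2
        \<le> measure_pmf.prob (run (direction_query p1 dir t1 t2) (alg G w)) {(S, vs). S = {t1, t2}}"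
      by (simp add: prob_output_eq)
    with run_queries_within[OF within] show ?thesis by blast
  qed
  ultimately show ?thesis by (intro exI[of _ alg] exI[of _ bound]) blast
qed

end
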